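(* Let $\mathcal{A}=(Q,\Sigma,\delta)$ be a synchronizing deterministic finite automaton with $n=|Q|$ states. Let $u\in\Sigma^*$ be a word of length $l$ and corank $r$ with $1\leqslant r\leqslant n/2-1$. Assume that, for an integer $\lambda$, there exists a word $v$ of length $\lambda$ such that $\operatorname{rk}v\leqslant\operatorname{rk}v'$ for every word $v'$ of length at most $\lambda+2r$. Then there is a word of length at most $l+\lambda+2r$ and corank at least $r+1$.
   Context: A deterministic finite automaton $\mathcal{A}=(Q,\Sigma,\delta)$ has a finite state set $Q$, finite alphabet $\Sigma$ and total transition function $\delta:Q\times\Sigma\to Q$, extended to an action of $\Sigma^*$ on $Q$ written $q\cdot w$; $Q\cdot w=\{q\cdot w:q\in Q\}$. The rank of a word $w$ is $\operatorname{rk}w=|Q\cdot w|$, and its corank is $n-\operatorname{rk}w$ where $n=|Q|$. $\mathcal{A}$ is synchronizing if some word has rank $1$. *)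

theory Defs
  imports Main
begin

definition dfa :: "'q set \<Rightarrow> 'a set \<Rightarrow> ('q \<Rightarrow> 'a \<Rightarrow> 'q) \<Rightarrow> bool" where
  "dfa Q \<Sigma> \<delta> \<longleftrightarrow> finite Q \<and> Q \<noteq> {} \<and> finite \<Sigma> \<and> (\<forall>q\<in>Q. \<forall>a\<in>\<Sigma>. \<delta> q a \<in> Q)"

definition act :: "('q \<Rightarrow> 'a \<Rightarrow> 'q) \<Rightarrow> 'q \<Rightarrow> 'a list \<Rightarrow> 'q" where
  "act \<delta> q w = foldl \<delta> q w"

definition img :: "'q set \<Rightarrow> ('q \<Rightarrow> 'a \<Rightarrow> 'q) \<Rightarrow> 'a list \<Rightarrow> 'q set" where
  "img Q \<delta> w = (\<lambda>q. act \<delta> q w) ` Q"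

definition rk :: "'q set \<Rightarrow> ('q \<Rightarrow> 'a \<Rightarrow> 'q) \<Rightarrow> 'a list \<Rightarrow> nat" where
  "rk Q \<delta> w = card (img Q \<delta> w)"

definition corank :: "'q set \<Rightarrow> ('q \<Rightarrow> 'a \<Rightarrow> 'q) \<Rightarrow> 'a list \<Rightarrow> nat" where
  "corank Q \<delta> w = card Q - rk Q \<delta> w"

definition synchronizing :: "'q set \<Rightarrow> 'a set \<Rightarrow> ('q \<Rightarrow> 'a \<Rightarrow> 'q) \<Rightarrow> bool" where
  "synchronizing Q \<Sigma> \<delta> \<longleftrightarrow> (\<exists>w\<in>lists \<Sigma>. rk Q \<delta> w = 1)"

end

theory Submission
  imports Defs "HOL-Library.Function_Algebras" Complex_Main
begin

text \<open>
  Suppose no such word exists, let \<open>m\<close> be the rank of \<open>v\<close>, and let \<open>S\<close> be the set of states that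
  form a kernel class of \<open>u\<close> on their own, so that \<open>Q - S\<close> has at most \<open>2 r\<close> elements. For
  \<open>y\<close> of length at most \<open>2 r\<close> the word \<open>v y u\<close> has the same rank as \<open>u\<close>, which forces
  \<open>S \<subseteq> Q \<cdot> v y\<close>, while \<open>Q \<cdot> v y\<close> has \<open>m\<close> elements. Hence the indicator vectors \<open>f\<close> of the sets
  \<open>Q \<cdot> v y\<close> satisfy the linear conditions \<open>sum f Q = m * f p\<close> for all \<open>p \<in> S\<close>. These cut out a
  space of dimension at most \<open>2 r\<close>, so the spans of the indicators for \<open>length y \<le> j\<close>
  become stationary at some \<open>j < 2 r\<close>, and the stationary span is invariant under the action of all
  letters. A reset word then puts a vector of sum \<open>m\<close> supported at a single state into this
  span; it must be nonzero on all of \<open>S\<close>, although \<open>S\<close> has at least two elements.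
\<close>

section \<open>Counting independent vectors along growing spans, and points in non-singleton
  fibres\<close>

lemma (in vector_space) ascending_spans_independent:
  assumes mono: "\<And>i. G i \<subseteq> G (Suc i)"
    and nz: "x \<in> G 0" "x \<noteq> 0"
    and grow: "\<And>j. j < k \<Longrightarrow> \<not> G (Suc j) \<subseteq> span (G j)"
  shows "\<exists>B \<subseteq> G k. independent B \<and> finite B \<and> card B = Suc k"
  using grow
proof (induction k)
  case 0
  have "independent {x}" using nz(2) by (simp add: dependent_single)
  then show ?case using nz(1) by (intro exI[of _ "{x}"]) auto
next
  case (Suc k)
  then obtain B where B: "B \<subseteq> G k" "independent B" "finite B" "card B = Suc k"
    by (meson less_SucI)
  obtain g where g: "g \<in> G (Suc k)" "g \<notin> span (G k)"
    using Suc.prems[of k] by blast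
  have gB: "g \<notin> span B" using g(2) span_mono[OF B(1)] by blast
  then have "g \<notin> B" using span_base by blast
  moreover have "independent (insert g B)" using gB B(2) by (rule independent_insertI)
  ultimately show ?case
    using B g(1) mono[of k] by (intro exI[of _ "insert g B"]) auto
qed

text \<open>Outside \<open>D\<close>, the set being counted, \<open>f\<close> is injective, so the
  whole loss of cardinality is \<open>card D\<close> minus the number of fibres meeting
  \<open>D\<close>. Each of these fibres has at least two points, so the loss is at least half of
  \<open>card D\<close>.\<close>

lemma card_nonsingleton_fibres_le:
  assumes "finite Q"
  shows "card {q \<in> Q. \<exists>p\<in>Q. p \<noteq> q \<and> f p = f q} \<le> 2 * (card Q - card (f ` Q))"
proof -
  define D where "D = {q \<in> Q. \<exists>p\<in>Q. p \<noteq> q \<and> f p = f q}"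
  define S where "S = Q - D"
  have fin: "finite D" "finite S" and DQ: "D \<subseteq> Q" using assms by (auto simp: D_def S_def)
  have cQ: "card Q = card S + card D"
    using assms DQ fin by (simp add: S_def card_Diff_subset card_mono)
  have inj: "inj_on f S" by (auto simp: inj_on_def S_def D_def)
  have "f ` Q = f ` S \<union> f ` D" using DQ by (auto simp: S_def)
  moreover have "f x \<noteq> f y" if "x \<in> S" "y \<in> D" for x y
    using that by (simp add: S_def D_def) metis
  then have "f ` S \<inter> f ` D = {}" by blast
  ultimately have cf: "card (f ` Q) = card S + card (f ` D)"
    using fin inj by (simp add: card_Un_disjoint card_image)
  have "2 \<le> card {x \<in> D. f x = y}" if y: "y \<in> f ` D" for y
  proof -
    obtain q p where "q \<in> Q" "p \<in> Q" "p \<noteq> q" "f p = f q" "y = f q"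
      using y unfolding D_def by blast
    then have "{p, q} \<subseteq> {x \<in> D. f x = y}" by (auto simp: D_def)
    then have "card {p, q} \<le> card {x \<in> D. f x = y}" using fin by (intro card_mono) auto
    then show ?thesis using \<open>p \<noteq> q\<close> by simp
  qed
  then have "(\<Sum>y\<in>f ` D. 2) \<le> (\<Sum>y\<in>f ` D. card {x \<in> D. f x = y})" by (rule sum_mono)
  also have "\<dots> = card D"
    using sum.group[of D "f ` D" f "\<lambda>_. 1::nat"] fin by simp
  finally have "2 * card (f ` D) \<le> card D" by simp
  then show ?thesis using cQ cf unfolding D_def[symmetric] by simp
qed

section \<open>Rational vectors on states and their pushforward\<close>

interpretation fun_vs: vector_space "\<lambda>(c::rat) (f::'q \<Rightarrow> rat) x. c * f x"
  by unfold_locales (auto simp: fun_eq_iff algebra_simps)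

lemma sum_fun_apply:
  fixes g :: "'i \<Rightarrow> 'q \<Rightarrow> 'b::comm_monoid_add"
  shows "(\<Sum>i\<in>I. g i) x = (\<Sum>i\<in>I. g i x)"
  by (induction I rule: infinite_finite_induct) auto

text \<open>The pushforward of a signed mass distribution on \<open>Q\<close>: the mass at
  \<open>p\<close> moves to \<open>h p\<close>.\<close>

definition push :: "'q set \<Rightarrow> ('q \<Rightarrow> 'q) \<Rightarrow> ('q \<Rightarrow> rat) \<Rightarrow> 'q \<Rightarrow> rat" where
  "push Q h f q = (\<Sum>p\<in>{p \<in> Q. h p = q}. f p)"

text \<open>Injectivity lets each fibre meet \<open>A\<close> in at most one point, so no masses add
  up to more than 1.\<close>

lemma push_of_bool:
  assumes "finite Q" "A \<subseteq> Q" "inj_on h A"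
  shows "push Q h (\<lambda>q. of_bool (q \<in> A)) = (\<lambda>q. of_bool (q \<in> h ` A))"
proof
  fix q
  have "push Q h (\<lambda>q. of_bool (q \<in> A)) q = (\<Sum>p\<in>{p \<in> A. h p = q}. 1)"
    unfolding push_def using assms(1,2) by (intro sum.mono_neutral_cong_right) auto
  also have "\<dots> = of_bool (q \<in> h ` A)"
  proof (cases "q \<in> h ` A")
    case True
    then obtain p where "p \<in> A" "q = h p" by blast
    then have "{p \<in> A. h p = q} = {p}" using assms(3) by (auto simp: inj_on_def)
    then show ?thesis using True by simp
  next
    case False
    then have no_preimage: "{p \<in> A. h p = q} = {}" by auto
    show ?thesis unfolding no_preimage using False by simp
  qed
  finally show "push Q h (\<lambda>q. of_bool (q \<in> A)) q = of_bool (q \<in> h ` A)" .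
qed

lemma sum_push:
  assumes "finite Q" "h ` Q \<subseteq> Q"
  shows "sum (push Q h f) Q = sum f Q"
  unfolding push_def using assms by (intro sum.group) auto

lemma push_support:
  assumes "push Q h f q \<noteq> 0"
  shows "\<exists>p\<in>Q. h p = q \<and> f p \<noteq> 0"
proof -
  obtain p where "p \<in> {p \<in> Q. h p = q}" "f p \<noteq> 0"
    using assms unfolding push_def by (rule sum.not_neutral_contains_not_neutral)
  then show ?thesis by blast
qed

text \<open>Since \<open>push\<close> is linear, invariance of a span need only be checked on its
  generators.\<close>

lemma push_span:
  assumes "\<And>g. g \<in> G \<Longrightarrow> push Q h g \<in> fun_vs.span G" and "f \<in> fun_vs.span G"
  shows "push Q h f \<in> fun_vs.span G"
  using assms(2)
proof (induction rule: fun_vs.span_induct_alt)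
  case base
  have "push Q h 0 = 0" by (auto simp: push_def fun_eq_iff)
  then show ?case by (metis fun_vs.span_zero)
next
  case (step c x y)
  have "push Q h ((\<lambda>q. c * x q) + y) = (\<lambda>q. c * push Q h x q) + push Q h y"
    by (auto simp: push_def fun_eq_iff sum.distrib sum_distrib_left)
  then show ?case
    using step assms(1) by (metis fun_vs.span_add fun_vs.span_scale)
qed

section \<open>Action of words on states and on vectors\<close>

lemma act_append: "act \<delta> q (x @ y) = act \<delta> (act \<delta> q x) y"
  by (simp add: act_def)

lemma img_append: "img Q \<delta> (x @ y) = img (img Q \<delta> x) \<delta> y"
  by (auto simp: img_def act_append)

lemma act_closed:
  assumes "dfa Q \<Sigma> \<delta>" "w \<in> lists \<Sigma>" "q \<in> Q"
  shows "act \<delta> q w \<in> Q"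
  using assms(2,3)
proof (induction w arbitrary: q)
  case Nil
  then show ?case by (simp add: act_def)
next
  case (Cons a w)
  then show ?case using assms(1) by (auto simp: act_def dfa_def)
qed

lemma img_subset:
  assumes "dfa Q \<Sigma> \<delta>" "w \<in> lists \<Sigma>"
  shows "img Q \<delta> w \<subseteq> Q"
  using act_closed[OF assms] by (auto simp: img_def)

text \<open>The vector is pushed along the letters of \<open>w\<close> one after another; each push
  stays in the span, conserves the sum and carries the support along. For a reset word the support
  in \<open>Q\<close> shrinks to at most one state.\<close>

lemma iterated_push:
  assumes "dfa Q \<Sigma> \<delta>" "w \<in> lists \<Sigma>"
    and "\<And>g a. g \<in> G \<Longrightarrow> a \<in> \<Sigma> \<Longrightarrow> push Q (\<lambda>q. \<delta> q a) g \<in> fun_vs.span G"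
    and "f \<in> fun_vs.span G"
  shows "\<exists>f' \<in> fun_vs.span G. sum f' Q = sum f Q \<and> (\<forall>q\<in>Q. f' q \<noteq> 0 \<longrightarrow> q \<in> img Q \<delta> w)"
  using assms(2)
proof (induction w rule: rev_induct)
  case Nil
  then show ?case using assms(4) by (auto simp: img_def act_def)
next
  case (snoc a w)
  then obtain f' where f': "f' \<in> fun_vs.span G" "sum f' Q = sum f Q"
      "\<forall>q\<in>Q. f' q \<noteq> 0 \<longrightarrow> q \<in> img Q \<delta> w"
    by auto
  have a: "a \<in> \<Sigma>" using snoc.prems by simp
  let ?h = "\<lambda>q. \<delta> q a"
  have "push Q ?h f' \<in> fun_vs.span G"
    by (rule push_span) (use assms(3) a f'(1) in auto)
  moreover have "sum (push Q ?h f') Q = sum f Q"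
    using assms(1) a f'(2) by (subst sum_push) (auto simp: dfa_def)
  moreover have "q \<in> img Q \<delta> (w @ [a])" if "push Q ?h f' q \<noteq> 0" for q
  proof -
    from push_support[OF that] obtain p where "p \<in> Q" "\<delta> p a = q" "f' p \<noteq> 0" by blast
    then show ?thesis using f'(3) unfolding img_append by (auto simp: img_def act_def)
  qed
  ultimately show ?case by blast
qed

section \<open>The linear conditions and the dimension they leave\<close>

lemma span_linear_condition:
  assumes "f \<in> fun_vs.span G" and "\<And>g. g \<in> G \<Longrightarrow> sum g Q = m * g p"
  shows "sum f Q = m * f p"
  using assms(1)
proof (induction rule: fun_vs.span_induct_alt)
  case base
  then show ?case by simp
next
  case (step c x y)
  then show ?case
    using assms(2)[of x] by (simp add: sum.distrib sum_distrib_left[symmetric] algebra_simps)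
qed

text \<open>The conditions make each vector constant on \<open>S\<close>, so \<open>B\<close> lies
  in the span of the indicator of \<open>S\<close> and the unit vectors outside \<open>S\<close>, of
  dimension at most \<open>card (Q - S) + 1\<close>. The unit vector at \<open>d\<close> has sum 1
  but vanishes on \<open>S\<close>, so it violates the conditions and the span of \<open>B\<close>
  is a proper subspace.\<close>

lemma card_independent_le:
  fixes m :: rat and B :: "('q \<Rightarrow> rat) set"
  assumes fin: "finite Q" and S: "S \<subseteq> Q" "S \<noteq> {}" and d: "d \<in> Q - S" and m: "m \<noteq> 0"
    and indep: "fun_vs.independent B"
    and supp: "\<And>f q. f \<in> B \<Longrightarrow> q \<notin> Q \<Longrightarrow> f q = 0"
    and lin: "\<And>f p. f \<in> B \<Longrightarrow> p \<in> S \<Longrightarrow> sum f Q = m * f p"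
  shows "finite B \<and> card B \<le> card (Q - S)"
proof -
  let ?e = "\<lambda>d q. of_bool (q = d) :: rat"
  let ?one = "\<lambda>q. of_bool (q \<in> S) :: rat"
  let ?T = "insert ?one (?e ` (Q - S))"
  obtain s where s: "s \<in> S" using S by blast
  have e_notin: "?e d \<notin> fun_vs.span B"
  proof
    assume "?e d \<in> fun_vs.span B"
    then have "sum (?e d) Q = m * ?e d s"
      by (rule span_linear_condition) (use lin s in blast)
    moreover have "sum (?e d) Q = 1" using fin d by simp
    moreover have "?e d s = 0" using d s by auto
    ultimately show False by simp
  qed
  have B_span: "f \<in> fun_vs.span ?T" if f: "f \<in> B" for f
  proof -
    have const: "f p = f s" if "p \<in> S" for p
      using lin[OF f that] lin[OF f s] m by simp
    have decomp: "f = (\<lambda>q. f s * ?one q) + (\<Sum>x\<in>Q - S. (\<lambda>q. f x * ?e x q))"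
    proof
      fix q
      have "(\<Sum>x\<in>Q - S. f x * ?e x q) = (if q \<in> Q - S then f q else 0)"
        using fin by (simp add: of_bool_def if_distrib[of "\<lambda>x. _ * x"] cong: if_cong)
      then show "f q = ((\<lambda>q. f s * ?one q) + (\<Sum>x\<in>Q - S. (\<lambda>q. f x * ?e x q))) q"
        using const supp[OF f] S(1) by (auto simp: sum_fun_apply)
    qed
    have one: "(\<lambda>q. f s * ?one q) \<in> fun_vs.span ?T"
      by (rule fun_vs.span_scale[of ?one ?T "f s"], rule fun_vs.span_base) simp
    have "(\<lambda>q. f x * ?e x q) \<in> fun_vs.span ?T" if "x \<in> Q - S" for x
      by (rule fun_vs.span_scale[of "?e x" ?T "f x"], rule fun_vs.span_base) (use that in simp)
    then have rest: "(\<Sum>x\<in>Q - S. (\<lambda>q. f x * ?e x q)) \<in> fun_vs.span ?T"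
      by (rule fun_vs.span_sum)
    show ?thesis by (subst decomp) (rule fun_vs.span_add[OF one rest])
  qed
  have "?e d \<in> fun_vs.span ?T" using d by (intro fun_vs.span_base) simp
  \<comment> \<open>Counting \<open>?e d\<close> together with \<open>B\<close> saves the one
    dimension contributed by \<open>?one\<close>.\<close>
  with B_span have "insert (?e d) B \<subseteq> fun_vs.span ?T" by blast
  moreover have "fun_vs.independent (insert (?e d) B)"
    using e_notin indep by (rule fun_vs.independent_insertI)
  ultimately have bound: "finite (insert (?e d) B)" "card (insert (?e d) B) \<le> card ?T"
    using fun_vs.independent_span_bound[of ?T "insert (?e d) B"] fin by auto
  have "card ?T \<le> Suc (card (?e ` (Q - S)))" by (rule card_insert_le_m1) simp_all
  also have "card (?e ` (Q - S)) \<le> card (Q - S)" using fin by (intro card_image_le) simp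
  finally have "card ?T \<le> Suc (card (Q - S))" by simp
  moreover have "?e d \<notin> B" using e_notin fun_vs.span_base by blast
  ultimately show ?thesis using bound by auto
qed

section \<open>Raising the corank beyond \<open>r\<close>\<close>

theorem theorem2:
  fixes Q :: "'q set" and \<Sigma> :: "'a set" and \<delta> :: "'q \<Rightarrow> 'a \<Rightarrow> 'q"
    and u v :: "'a list" and l r lam :: nat
  assumes "dfa Q \<Sigma> \<delta>" and "synchronizing Q \<Sigma> \<delta>"
    and "u \<in> lists \<Sigma>" and "length u = l" and "corank Q \<delta> u = r"
    and "1 \<le> r" and "2 * (r + 1) \<le> card Q"
    and "v \<in> lists \<Sigma>" and "length v = lam"
    and "\<forall>v'\<in>lists \<Sigma>. length v' \<le> lam + 2 * r \<longrightarrow> rk Q \<delta> v \<le> rk Q \<delta> v'"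
  shows "\<exists>w\<in>lists \<Sigma>. length w \<le> l + lam + 2 * r \<and> corank Q \<delta> w \<ge> r + 1"
proof (rule ccontr)
  assume neg: "\<not> ?thesis"
  have fin: "finite Q" and ne: "Q \<noteq> {}" using assms(1) by (auto simp: dfa_def)
  let ?fu = "\<lambda>q. act \<delta> q u"
  define S where "S = {q \<in> Q. \<forall>p\<in>Q. ?fu p = ?fu q \<longrightarrow> p = q}"
  define m :: rat where "m = of_nat (rk Q \<delta> v)"
  define I where "I y = (\<lambda>q. of_bool (q \<in> img Q \<delta> (v @ y)) :: rat)" for y
  define G where "G i = I ` {y \<in> lists \<Sigma>. length y \<le> i}" for i
  have SQ: "S \<subseteq> Q" and finS: "finite S" using fin by (auto simp: S_def)
  have QS: "Q - S = {q \<in> Q. \<exists>p\<in>Q. p \<noteq> q \<and> ?fu p = ?fu q}" by (auto simp: S_def)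
  have cD: "card (Q - S) \<le> 2 * r"
    unfolding QS using card_nonsingleton_fibres_le[OF fin, of ?fu] assms(5)
    by (simp add: corank_def rk_def img_def)
  \<comment> \<open>The bound \<open>2 * (r + 1) \<le> card Q\<close> leaves two states in
    \<open>S\<close>, which the final contradiction requires.\<close>
  have cS: "2 \<le> card S"
    using cD assms(7) card_Diff_subset[OF finS SQ] by arith
  \<comment> \<open>Positive corank means that \<open>u\<close> merges two states; one of them
    serves as \<open>d\<close> in \<open>card_independent_le\<close>.\<close>
  have DS: "Q - S \<noteq> {}"
  proof
    assume "Q - S = {}"
    then have "inj_on ?fu Q" by (auto simp: QS inj_on_def)
    then show False using assms(5,6) by (simp add: corank_def rk_def img_def card_image)
  qed
  have m0: "m \<noteq> 0" using fin ne by (simp add: m_def rk_def img_def)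

  have imgQ: "img Q \<delta> (v @ y) \<subseteq> Q" if "y \<in> lists \<Sigma>" for y
    using img_subset[OF assms(1)] assms(8) that by simp
  \<comment> \<open>Appending \<open>y\<close> cannot raise the rank, and the minimality of the rank
    of \<open>v\<close> prevents it from dropping.\<close>
  have cardI: "card (img Q \<delta> (v @ y)) = rk Q \<delta> v"
    if "y \<in> lists \<Sigma>" "length y \<le> 2 * r" for y
  proof (rule antisym)
    show "card (img Q \<delta> (v @ y)) \<le> rk Q \<delta> v"
      unfolding img_append rk_def img_def[of "img Q \<delta> v"]
      using fin by (intro card_image_le) (simp add: img_def)
    show "rk Q \<delta> v \<le> card (img Q \<delta> (v @ y))"
      using that assms(8,9,10) by (simp add: rk_def)
  qed
  \<comment> \<open>The word \<open>v @ y @ u\<close> is short enough for \<open>neg\<close>, so its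
    image is all of the image of \<open>u\<close>. Hence \<open>?fu s\<close> is reached from some
    state of \<open>img Q \<delta> (v @ y)\<close>, and only \<open>s\<close> itself is mapped
    there.\<close>
  have S_img: "S \<subseteq> img Q \<delta> (v @ y)" if y: "y \<in> lists \<Sigma>" "length y \<le> 2 * r" for y
  proof
    fix s assume s: "s \<in> S"
    have "v @ y @ u \<in> lists \<Sigma>" "length (v @ y @ u) \<le> l + lam + 2 * r"
      using y assms(3,4,8,9) by simp_all
    then have "\<not> r + 1 \<le> corank Q \<delta> (v @ y @ u)" using neg by blast
    then have "corank Q \<delta> (v @ y @ u) \<le> r" by simp
    then have "rk Q \<delta> u \<le> rk Q \<delta> (v @ y @ u)"
      using assms(5,6) by (simp add: corank_def)
    moreover have "img Q \<delta> (v @ y @ u) \<subseteq> img Q \<delta> u"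
      using imgQ[OF y(1)] img_append[of Q \<delta> "v @ y" u] by (auto simp: img_def)
    ultimately have "img Q \<delta> (v @ y @ u) = img Q \<delta> u"
      using fin by (intro card_seteq) (auto simp: rk_def img_def)
    then have "?fu s \<in> ?fu ` img Q \<delta> (v @ y)"
      using s img_append[of Q \<delta> "v @ y" u] by (auto simp: img_def S_def)
    then obtain p where "p \<in> img Q \<delta> (v @ y)" "?fu p = ?fu s" by force
    then show "s \<in> img Q \<delta> (v @ y)"
      using s imgQ[OF y(1)] by (auto simp: S_def)
  qed
  have sumI: "sum (I y) Q = m" if "y \<in> lists \<Sigma>" "length y \<le> 2 * r" for y
  proof -
    have "img Q \<delta> (v @ y) \<subseteq> Q" using that(1) by (rule imgQ)
    then have "Q \<inter> img Q \<delta> (v @ y) = img Q \<delta> (v @ y)" by blast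
    then show ?thesis using cardI[OF that] fin by (simp add: I_def m_def Int_def[symmetric])
  qed
  have linG: "sum g Q = m * g p" if g: "g \<in> G i" "i \<le> 2 * r" and p: "p \<in> S" for g i p
  proof -
    obtain y where y: "y \<in> lists \<Sigma>" "length y \<le> 2 * r" "g = I y"
      using g le_trans unfolding G_def by blast
    then have "p \<in> img Q \<delta> (v @ y)" using S_img p by blast
    then show ?thesis using sumI[OF y(1,2)] y(3) by (simp add: I_def)
  qed

  \<comment> \<open>Otherwise \<open>2 * r\<close> strict growth steps would give
    \<open>2 * r + 1\<close> independent vectors. Strictness of \<open>j < 2 * r\<close> leaves room
    for one more letter within the length bound of \<open>cardI\<close>.\<close>
  have "\<exists>j<2 * r. G (Suc j) \<subseteq> fun_vs.span (G j)"
  proof (rule ccontr)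
    assume "\<not> ?thesis"
    then have grow: "\<And>j. j < 2 * r \<Longrightarrow> \<not> G (Suc j) \<subseteq> fun_vs.span (G j)" by blast
    have mono: "G i \<subseteq> G (Suc i)" for i by (auto simp: G_def)
    have I0: "I [] \<in> G 0" by (auto simp: G_def)
    have Inz: "I [] \<noteq> 0" using sumI[of "[]"] m0 by auto
    obtain B where B: "B \<subseteq> G (2 * r)" "fun_vs.independent B" "card B = Suc (2 * r)"
      using fun_vs.ascending_spans_independent[OF mono I0 Inz grow] by blast
    obtain d where d: "d \<in> Q - S" using DS by blast
    have "finite B \<and> card B \<le> card (Q - S)"
    proof (rule card_independent_le[OF fin SQ _ d m0 B(2)])
      show "S \<noteq> {}" using cS by auto
      fix f assume f: "f \<in> B"
      show "f q = 0" if "q \<notin> Q" for q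
      proof -
        obtain y where "y \<in> lists \<Sigma>" "f = I y" using f B(1) unfolding G_def by blast
        then show ?thesis using imgQ \<open>q \<notin> Q\<close> by (auto simp: I_def)
      qed
      show "sum f Q = m * f p" if "p \<in> S" for p
        using f B(1) that linG by blast
    qed
    then show False using B(3) cD by simp
  qed
  then obtain j where j: "j < 2 * r" "G (Suc j) \<subseteq> fun_vs.span (G j)" by blast

  \<comment> \<open>The images of \<open>v @ y\<close> and \<open>v @ y @ [a]\<close> have equal
    size, so \<open>a\<close> is injective on the former and pushing \<open>I y\<close> gives
    \<open>I (y @ [a])\<close>, which stationarity returns to the span.\<close>
  have inv: "push Q (\<lambda>q. \<delta> q a) g \<in> fun_vs.span (G j)" if g: "g \<in> G j" and a: "a \<in> \<Sigma>" for g a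
  proof -
    obtain y where y: "y \<in> lists \<Sigma>" "length y \<le> j" "g = I y" using g unfolding G_def by blast
    have img_a: "img Q \<delta> (v @ y @ [a]) = (\<lambda>q. \<delta> q a) ` img Q \<delta> (v @ y)"
      using img_append[of Q \<delta> "v @ y" "[a]"] by (simp add: img_def act_def)
    have "card ((\<lambda>q. \<delta> q a) ` img Q \<delta> (v @ y)) = card (img Q \<delta> (v @ y))"
      using cardI[of y] cardI[of "y @ [a]"] y a j(1) img_a by simp
    then have "inj_on (\<lambda>q. \<delta> q a) (img Q \<delta> (v @ y))"
      using fin by (intro eq_card_imp_inj_on) (auto simp: img_def)
    moreover have "img Q \<delta> (v @ y) \<subseteq> Q" using y(1) by (rule imgQ)
    ultimately have "push Q (\<lambda>q. \<delta> q a) g = I (y @ [a])"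
      using y(3) push_of_bool[OF fin] by (simp add: I_def img_a)
    moreover have "I (y @ [a]) \<in> G (Suc j)" using y a by (auto simp: G_def)
    ultimately show ?thesis using j(2) by auto
  qed

  obtain w where w: "w \<in> lists \<Sigma>" "rk Q \<delta> w = 1" using assms(2) by (auto simp: synchronizing_def)
  then obtain t where t: "img Q \<delta> w = {t}" by (auto simp: rk_def card_1_singleton_iff)
  have "I [] \<in> fun_vs.span (G j)" by (intro fun_vs.span_base) (auto simp: G_def)
  from iterated_push[OF assms(1) w(1) inv this] obtain f where
    f: "f \<in> fun_vs.span (G j)" "sum f Q = sum (I []) Q" "\<forall>q\<in>Q. f q \<noteq> 0 \<longrightarrow> q = t"
    unfolding t by blast
  \<comment> \<open>The conserved sum \<open>m\<close> is nonzero and equals \<open>m * f p\<close>,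
    so \<open>f p\<close> cannot vanish.\<close>
  have "p = t" if p: "p \<in> S" for p
  proof -
    have "sum f Q = m * f p"
      by (rule span_linear_condition[OF f(1)]) (use linG j(1) p in auto)
    then have "f p \<noteq> 0" using f(2) sumI[of "[]"] m0 by auto
    then show ?thesis using f(3) p SQ by blast
  qed
  then have "S \<subseteq> {t}" by blast
  then have "card S \<le> 1" using card_mono[of "{t}" S] by simp
  then show False using cS by simp
qed

end
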